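(* Let $U\subseteq\mathbb{C}$ be an open set and $K\subset U$ a compact subset. Then there exists an open (polygonal) set $P$ such that $K\subset P\subset\overline{P}\subset U$ and, for every holomorphic function $f\colon U\to\mathbb{C}$, $$\frac{1}{2\pi \mathrm{i}}\int_{\partial P}\frac{f(\zeta)}{\zeta-z}\,d\zeta=\begin{cases} f(z), & z\in P,\\ 0, & z\in U\setminus\overline{P}.\end{cases}$$
   Context: Here a polygonal set $P$ means the interior of a finite union $\widetilde{P}=\bigcup_{j=1}^M Q_j$ of closed squares $Q_j$ taken from a lattice of congruent squares in $\mathbb{C}$ with sides parallel to the real and imaginary axes. Its boundary $\partial P$ is the union of those sides of the squares $Q_j$ that lie in the topological boundary of $\widetilde{P}$. Each such side belongs to exactly one $Q_j$ and is oriented as part of the positively (counter-clockwise) oriented boundary of that $Q_j$. The integral $\int_{\partial P}$ is the sum of the line integrals over these oriented sides. *)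

theory Defs
  imports "HOL-Complex_Analysis.Complex_Analysis"
begin

text \<open>A lattice of congruent axis-parallel squares is given by an origin \<^term>\<open>w :: complex\<close>,
  which is arbitrary, and a side length \<^term>\<open>h :: real\<close>, which is positive wherever the
  definitions are used. Its squares are indexed by their lower left vertices.\<close>

definition lattice_vertex :: "complex \<Rightarrow> real \<Rightarrow> int \<Rightarrow> int \<Rightarrow> complex" where
  "lattice_vertex w h m n = w + Complex (of_int m * h) (of_int n * h)"

definition lattice_square :: "complex \<Rightarrow> real \<Rightarrow> int \<times> int \<Rightarrow> complex set" where
  "lattice_square w h = (\<lambda>(m, n).
     cbox (lattice_vertex w h m n) (lattice_vertex w h (m + 1) (n + 1)))"

definition lattice_region :: "complex \<Rightarrow> real \<Rightarrow> (int \<times> int) set \<Rightarrow> complex set" where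
  "lattice_region w h J = (\<Union>j\<in>J. lattice_square w h j)"

definition polygonal_set :: "complex \<Rightarrow> real \<Rightarrow> (int \<times> int) set \<Rightarrow> complex set" where
  "polygonal_set w h J = interior (lattice_region w h J)"

text \<open>An oriented side is the pair of its start and end points; the four sides below run
  counter-clockwise around the square.\<close>

definition oriented_sides :: "complex \<Rightarrow> real \<Rightarrow> int \<times> int \<Rightarrow> (complex \<times> complex) set" where
  "oriented_sides w h = (\<lambda>(m, n).
     {(lattice_vertex w h m n, lattice_vertex w h (m + 1) n),
      (lattice_vertex w h (m + 1) n, lattice_vertex w h (m + 1) (n + 1)),
      (lattice_vertex w h (m + 1) (n + 1), lattice_vertex w h m (n + 1)),
      (lattice_vertex w h m (n + 1), lattice_vertex w h m n)})"

text \<open>Two adjacent squares traverse their common side in opposite directions, so for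
  \<^term>\<open>h > (0::real)\<close> an oriented side belongs to only one square, and no side is lost by
  collecting the sides of all squares in one set.\<close>

definition boundary_sides ::
    "complex \<Rightarrow> real \<Rightarrow> (int \<times> int) set \<Rightarrow> (complex \<times> complex) set" where
  "boundary_sides w h J =
     {(a, b) \<in> (\<Union>j\<in>J. oriented_sides w h j).
        closed_segment a b \<subseteq> frontier (lattice_region w h J)}"

definition boundary_integral ::
    "complex \<Rightarrow> real \<Rightarrow> (int \<times> int) set \<Rightarrow> (complex \<Rightarrow> complex) \<Rightarrow> complex" where
  "boundary_integral w h J g =
     (\<Sum>(a, b)\<in>boundary_sides w h J. contour_integral (linepath a b) g)"

end

theory Submission imports Defs begin

text \<open>On a lattice fine enough compared with the distance from \<open>K\<close> to the complement of
  \<open>U\<close>, the squares that meet a small neighbourhood of \<open>K\<close> are finitely many, lie in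
  \<open>U\<close>, and cover that neighbourhood, so that \<open>K\<close> lies in the interior of their union
  (\<open>lattice_region_between_compact_and_open\<close>). They form the region.

  A side of one of the squares that is not contained in the frontier of the region is shared with a
  neighbouring square of the region, which traverses it in the opposite direction
  (\<open>side_in_frontier\<close>). The integrals over these inner sides cancel, and the integral over
  the boundary of the region is the sum of the integrals over the boundaries of all its squares
  (\<open>boundary_integral_eq_sum\<close>).

  Applied to \<open>f \<zeta> / (\<zeta> - z)\<close>, this reduces everything to Cauchy's theorem and Cauchy's
  formula for a single square. If \<open>z\<close> is outside the region, every square contributes
  \<open>0\<close>; if \<open>z\<close> is in the open square of one member of the region, that square
  contributes \<open>2 \<pi> \<i> f z\<close> and the others \<open>0\<close>. The points of the polygonal set that
  lie on lattice lines remain, where the integrand is singular on the boundaries of some squares.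
  But both sides of the formula are continuous on the whole polygonal set, which is disjoint from
  the boundary sides, and the open squares are dense in it.\<close>

section \<open>Squares of a lattice\<close>

lemma lattice_vertex_sel [simp]:
  "Re (lattice_vertex w h m n) = Re w + of_int m * h"
  "Im (lattice_vertex w h m n) = Im w + of_int n * h"
  by (simp_all add: lattice_vertex_def)

lemma lattice_vertex_inject:
  assumes "h > 0"
  shows "lattice_vertex w h m n = lattice_vertex w h m' n' \<longleftrightarrow> m = m' \<and> n = n'"
  using assms by (auto simp: complex_eq_iff)

text \<open>The interior of \<^term>\<open>lattice_square w h j\<close>, given explicitly as an open box.\<close>

definition open_square :: "complex \<Rightarrow> real \<Rightarrow> int \<times> int \<Rightarrow> complex set" where
  "open_square w h = (\<lambda>(m, n).
     box (lattice_vertex w h m n) (lattice_vertex w h (m + 1) (n + 1)))"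

lemma closure_open_square: "h > 0 \<Longrightarrow> closure (open_square w h j) = lattice_square w h j"
  by (cases j) (auto simp: open_square_def lattice_square_def box_ne_empty Basis_complex_def
      algebra_simps closure_box)

lemma interior_lattice_square: "interior (lattice_square w h j) = open_square w h j"
  by (cases j) (simp add: open_square_def lattice_square_def interior_cbox)

lemma open_square_disjoint:
  assumes "h > 0" "j \<noteq> k"
  shows "open_square w h j \<inter> lattice_square w h k = {}"
proof -
  obtain m n m' n' where jk: "j = (m, n)" "k = (m', n')" by (cases j, cases k)
  have less: "p < q + 1" if "of_int p * h < (of_int q + 1) * h" for p q :: int
  proof -
    have "of_int p < (of_int q + 1 :: real)"
      using that assms(1) by simp
    then show ?thesis by linarith
  qed
  have "m = m' \<and> n = n'" if z: "z \<in> open_square w h j" "z \<in> lattice_square w h k" for z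
  proof -
    have "of_int m * h < (of_int m' + 1) * h" "of_int m' * h < (of_int m + 1) * h"
         "of_int n * h < (of_int n' + 1) * h" "of_int n' * h < (of_int n + 1) * h"
      using z by (auto simp: jk open_square_def lattice_square_def in_box_complex_iff
          in_cbox_complex_iff algebra_simps)
    then have "m < m' + 1" "m' < m + 1" "n < n' + 1" "n' < n + 1"
      using less by blast+
    then show ?thesis by linarith
  qed
  then show ?thesis using assms(2) jk by blast
qed

section \<open>The region and its interior\<close>

lemma compact_lattice_region: "finite J \<Longrightarrow> compact (lattice_region w h J)"
  by (auto simp: lattice_region_def lattice_square_def intro!: compact_UN)

lemma open_squares_subset_polygonal_set:
  "(\<Union>j\<in>J. open_square w h j) \<subseteq> polygonal_set w h J"
  unfolding polygonal_set_def lattice_region_def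
  using interior_lattice_square interior_mono by (metis UN_least UN_upper)

lemma lattice_region_eq_closure:
  assumes "h > 0" "finite J"
  shows "lattice_region w h J = closure (\<Union>j\<in>J. open_square w h j)"
proof -
  have "closure (\<Union>j\<in>J. open_square w h j) = (\<Union>j\<in>J. closure (open_square w h j))"
    using assms(2) by induction auto
  then show ?thesis using assms(1) by (simp add: lattice_region_def closure_open_square)
qed

text \<open>The region is a regular closed set: nothing of it is lost by passing to its interior.\<close>

lemma closure_polygonal_set:
  assumes "h > 0" "finite J"
  shows "closure (polygonal_set w h J) = lattice_region w h J"
proof
  show "closure (polygonal_set w h J) \<subseteq> lattice_region w h J"
    using compact_lattice_region[OF assms(2), of w h]
    by (metis polygonal_set_def closure_minimal compact_imp_closed interior_subset)
  show "lattice_region w h J \<subseteq> closure (polygonal_set w h J)"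
    using lattice_region_eq_closure[OF assms] closure_mono[OF open_squares_subset_polygonal_set]
    by metis
qed

section \<open>Cancellation of inner sides\<close>

lemma oriented_side_subset_square:
  assumes "h > 0" "(a, b) \<in> oriented_sides w h j"
  shows "closed_segment a b \<subseteq> lattice_square w h j"
proof -
  have "a \<in> lattice_square w h j" "b \<in> lattice_square w h j"
    using assms by (cases j; auto simp: oriented_sides_def lattice_square_def in_cbox_complex_iff
        algebra_simps)+
  moreover have "convex (lattice_square w h j)"
    by (cases j) (simp add: lattice_square_def)
  ultimately show ?thesis by (simp add: closed_segment_subset)
qed

lemma reversed_side_of_neighbour:
  assumes "(a, b) \<in> oriented_sides w h j"
  shows "\<exists>k. (b, a) \<in> oriented_sides w h k"
proof -
  obtain m n where j: "j = (m, n)" by (cases j)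
  \<comment> \<open>Across the bottom, right, top and left side, respectively.\<close>
  from assms consider
      "(b, a) \<in> oriented_sides w h (m, n - 1)" | "(b, a) \<in> oriented_sides w h (m + 1, n)"
    | "(b, a) \<in> oriented_sides w h (m, n + 1)" | "(b, a) \<in> oriented_sides w h (m - 1, n)"
    by (auto simp: j oriented_sides_def)
  then show ?thesis by cases blast+
qed

lemma oriented_sides_disjoint:
  assumes "h > 0" "j \<noteq> k"
  shows "oriented_sides w h j \<inter> oriented_sides w h k = {}"
proof -
  obtain m n m' n' where jk: "j = (m, n)" "k = (m', n')" by (cases j, cases k)
  have "m = m' \<and> n = n'" if "p \<in> oriented_sides w h (m, n)" "p \<in> oriented_sides w h (m', n')" for p
    using that unfolding oriented_sides_def prod.case
    by (elim insertE emptyE; simp add: lattice_vertex_inject[OF assms(1)])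
  then show ?thesis using assms(2) jk by blast
qed

text \<open>If the neighbour across a side is missing, then the points of that side are limits of
  points in the open neighbour, which is disjoint from the region.\<close>

lemma side_in_frontier:
  assumes h: "h > 0"
    and ab: "j \<in> J" "(a, b) \<in> oriented_sides w h j"
    and ba: "(b, a) \<in> oriented_sides w h k" "k \<notin> J"
  shows "closed_segment a b \<subseteq> frontier (lattice_region w h J)"
proof -
  have "open_square w h k \<inter> lattice_region w h J = {}"
  proof -
    have "open_square w h k \<inter> lattice_square w h i = {}" if "i \<in> J" for i
      using ba(2) that by (intro open_square_disjoint[OF h]) auto
    then show ?thesis by (auto simp: lattice_region_def)
  qed
  then have "closure (open_square w h k) \<subseteq> closure (- lattice_region w h J)"
    by (intro closure_mono) blast
  then have "closed_segment a b \<subseteq> closure (- lattice_region w h J)"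
    using oriented_side_subset_square[OF h ba(1)]
    by (simp add: closure_open_square[OF h] closed_segment_commute)
  moreover have "closed_segment a b \<subseteq> closure (lattice_region w h J)"
  proof -
    have "lattice_square w h j \<subseteq> lattice_region w h J"
      using ab(1) by (auto simp: lattice_region_def)
    then show ?thesis
      using oriented_side_subset_square[OF h ab(2)] closure_subset by (meson subset_trans)
  qed
  ultimately show ?thesis by (simp add: frontier_closures)
qed

text \<open>The boundary of the square with index \<open>j\<close> as one closed path, traversed
  counter-clockwise from the lower left vertex.\<close>

abbreviation square_path :: "complex \<Rightarrow> real \<Rightarrow> int \<times> int \<Rightarrow> real \<Rightarrow> complex" where
  "square_path w h j \<equiv> rectpath (lattice_vertex w h (fst j) (snd j))
     (lattice_vertex w h (fst j + 1) (snd j + 1))"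

lemma sum_oriented_sides:
  assumes h: "h > 0" and g: "(g has_contour_integral I) (square_path w h j)"
  shows "(\<Sum>(a, b)\<in>oriented_sides w h j. contour_integral (linepath a b) g) = I"
proof -
  obtain m n where j: "j = (m, n)" by (cases j)
  have path: "rectpath (lattice_vertex w h m n) (lattice_vertex w h (m + 1) (n + 1)) =
      linepath (lattice_vertex w h m n) (lattice_vertex w h (m + 1) n) +++
      linepath (lattice_vertex w h (m + 1) n) (lattice_vertex w h (m + 1) (n + 1)) +++
      linepath (lattice_vertex w h (m + 1) (n + 1)) (lattice_vertex w h m (n + 1)) +++
      linepath (lattice_vertex w h m (n + 1)) (lattice_vertex w h m n)"
  proof -
    have "Complex (Re (lattice_vertex w h (m + 1) (n + 1))) (Im (lattice_vertex w h m n))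
            = lattice_vertex w h (m + 1) n"
         "Complex (Re (lattice_vertex w h m n)) (Im (lattice_vertex w h (m + 1) (n + 1)))
            = lattice_vertex w h m (n + 1)"
      by (simp_all add: complex_eq_iff)
    then show ?thesis by (simp add: rectpath_def Let_def)
  qed
  have "contour_integral (square_path w h j) g = I" "g contour_integrable_on square_path w h j"
    using g by (auto simp: contour_integral_unique contour_integrable_on_def)
  then show ?thesis
    using h by (simp add: path j oriented_sides_def lattice_vertex_inject)
qed

text \<open>Integrability is required on the boundaries of all squares, inner sides included; in the
  application this excludes singularities on the lattice lines.\<close>

lemma boundary_integral_eq_sum:
  assumes h: "h > 0" and J: "finite J"
    and g: "\<And>j. j \<in> J \<Longrightarrow> (g has_contour_integral I j) (square_path w h j)"
  shows "boundary_integral w h J g = (\<Sum>j\<in>J. I j)"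
proof -
  define A where "A = (\<Union>j\<in>J. oriented_sides w h j)"
  \<comment> \<open>The inner sides: this set is closed under reversal, so its integrals sum to
    their own negative.\<close>
  define S where "S = A - boundary_sides w h J"
  let ?c = "\<lambda>(a, b). contour_integral (linepath a b) g"
  have fin_sides: "finite (oriented_sides w h j)" for j
    by (cases j) (simp add: oriented_sides_def)
  then have finA: "finite A" using J by (simp add: A_def)
  have swapS: "prod.swap ` S \<subseteq> S"
  proof clarsimp
    fix a b assume ab: "(a, b) \<in> S"
    then obtain j where j: "j \<in> J" "(a, b) \<in> oriented_sides w h j"
      by (auto simp: S_def A_def)
    have nf: "\<not> closed_segment a b \<subseteq> frontier (lattice_region w h J)"
      using ab by (auto simp: S_def A_def boundary_sides_def)
    obtain k where k: "(b, a) \<in> oriented_sides w h k"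
      using reversed_side_of_neighbour[OF j(2)] by blast
    have "k \<in> J" using side_in_frontier[OF h j k] nf by blast
    then show "(b, a) \<in> S"
      using k nf by (auto simp: S_def A_def boundary_sides_def closed_segment_commute)
  qed
  then have swapS': "prod.swap ` S = S"
    by (metis image_subset_iff rev_image_eqI subset_antisym subsetI swap_swap)
  have "sum ?c S = sum ?c (prod.swap ` S)" by (simp add: swapS')
  also have "\<dots> = (\<Sum>p\<in>S. - ?c p)"
  proof -
    have "?c (prod.swap p) = - ?c p" for p
      using contour_integral_reversepath[OF valid_path_linepath, of "fst p" "snd p" g]
      by (simp add: case_prod_unfold)
    then show ?thesis by (simp add: sum.reindex)
  qed
  finally have S0: "sum ?c S = 0" by (simp add: sum_negf)
  have "boundary_sides w h J \<subseteq> A" by (auto simp: boundary_sides_def A_def)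
  then have "sum ?c A = sum ?c (boundary_sides w h J)"
    using sum.subset_diff[OF _ finA, of "boundary_sides w h J" ?c] S0 by (simp add: S_def)
  moreover have "sum ?c A = (\<Sum>j\<in>J. sum ?c (oriented_sides w h j))"
    unfolding A_def using J fin_sides oriented_sides_disjoint[OF h]
    by (intro sum.UNION_disjoint) auto
  moreover have "\<dots> = (\<Sum>j\<in>J. I j)"
    using sum_oriented_sides[OF h g] by (intro sum.cong) auto
  ultimately show ?thesis by (simp add: boundary_integral_def)
qed

section \<open>Cauchy's theorem and formula off the lattice lines\<close>

lemma square_cauchy_theorem:
  assumes h: "h > 0" and f: "f holomorphic_on lattice_square w h j" and z: "z \<notin> lattice_square w h j"
  shows "((\<lambda>\<zeta>. f \<zeta> / (\<zeta> - z)) has_contour_integral 0) (square_path w h j)"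
proof (rule Cauchy_theorem_convex_simple)
  show "(\<lambda>\<zeta>. f \<zeta> / (\<zeta> - z)) holomorphic_on lattice_square w h j"
    using z by (intro holomorphic_intros f) auto
  show "path_image (square_path w h j) \<subseteq> lattice_square w h j"
    using h path_image_rectpath_subset_cbox by (cases j) (simp add: lattice_square_def)
qed (cases j; simp add: lattice_square_def)+

lemma square_cauchy_formula:
  assumes h: "h > 0" and f: "f holomorphic_on lattice_square w h j" and z: "z \<in> open_square w h j"
  shows "((\<lambda>\<zeta>. f \<zeta> / (\<zeta> - z)) has_contour_integral (2 * pi * \<i> * f z)) (square_path w h j)"
proof -
  obtain m n where j: "j = (m, n)" by (cases j)
  have box: "z \<in> box (lattice_vertex w h m n) (lattice_vertex w h (m + 1) (n + 1))"
    using z by (simp add: j open_square_def)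
  have "((\<lambda>\<zeta>. f \<zeta> / (\<zeta> - z)) has_contour_integral
      (2 * pi * \<i> * winding_number (square_path w h j) z * f z)) (square_path w h j)"
  proof (rule Cauchy_integral_formula_convex_simple[OF _ f])
    show "z \<in> interior (lattice_square w h j)"
      using z by (simp add: interior_lattice_square)
    show "path_image (square_path w h j) \<subseteq> lattice_square w h j - {z}"
      using h box path_image_rectpath_cbox_minus_box
      by (auto simp: j lattice_square_def)
  qed (simp_all add: j lattice_square_def)
  then show ?thesis
    using winding_number_rectpath[OF box] by (simp add: j)
qed

lemma boundary_integral_cauchy_formula_open_square:
  assumes h: "h > 0" and J: "finite J" and f: "f holomorphic_on lattice_region w h J"
    and k: "k \<in> J" "z \<in> open_square w h k"
  shows "boundary_integral w h J (\<lambda>\<zeta>. f \<zeta> / (\<zeta> - z)) = 2 * pi * \<i> * f z"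
proof -
  have "((\<lambda>\<zeta>. f \<zeta> / (\<zeta> - z)) has_contour_integral (if j = k then 2 * pi * \<i> * f z else 0))
      (square_path w h j)" if "j \<in> J" for j
  proof -
    have fj: "f holomorphic_on lattice_square w h j"
      using f that by (rule_tac holomorphic_on_subset) (auto simp: lattice_region_def)
    show ?thesis
    proof (cases "j = k")
      case True
      then show ?thesis using square_cauchy_formula[OF h fj] k(2) by simp
    next
      case False
      then have "z \<notin> lattice_square w h j"
        using open_square_disjoint[OF h, of k j w] k(2) by blast
      then show ?thesis using False square_cauchy_theorem[OF h fj] by simp
    qed
  qed
  from boundary_integral_eq_sum[OF h J this] show ?thesis
    using J k(1) by simp
qed

lemma boundary_integral_cauchy_theorem:
  assumes h: "h > 0" and J: "finite J" and f: "f holomorphic_on lattice_region w h J"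
    and z: "z \<notin> lattice_region w h J"
  shows "boundary_integral w h J (\<lambda>\<zeta>. f \<zeta> / (\<zeta> - z)) = 0"
proof -
  have "((\<lambda>\<zeta>. f \<zeta> / (\<zeta> - z)) has_contour_integral 0) (square_path w h j)" if "j \<in> J" for j
  proof (rule square_cauchy_theorem[OF h])
    show "f holomorphic_on lattice_square w h j"
      using f that by (rule_tac holomorphic_on_subset) (auto simp: lattice_region_def)
    show "z \<notin> lattice_square w h j" using z that by (auto simp: lattice_region_def)
  qed
  from boundary_integral_eq_sum[OF h J this] show ?thesis by simp
qed

section \<open>Extension to the lattice lines by continuity\<close>

text \<open>A Cauchy integral over a segment is even differentiable in the parameter \<open>z\<close>.\<close>

lemma continuous_on_cauchy_integral_linepath:
  assumes f: "continuous_on (closed_segment a b) f"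
  shows "continuous_on (- closed_segment a b)
    (\<lambda>z. contour_integral (linepath a b) (\<lambda>\<zeta>. f \<zeta> / (\<zeta> - z)))"
proof (rule continuous_at_imp_continuous_on, rule ballI)
  fix z assume z: "z \<in> - closed_segment a b"
  have int: "((\<lambda>\<zeta>. f \<zeta> / (\<zeta> - v) ^ 1) has_contour_integral
      contour_integral (linepath a b) (\<lambda>\<zeta>. f \<zeta> / (\<zeta> - v))) (linepath a b)"
    if "v \<in> UNIV - path_image (linepath a b)" for v
  proof -
    have "continuous_on (closed_segment a b) (\<lambda>\<zeta>. f \<zeta> / (\<zeta> - v))"
      using that by (intro continuous_intros f) auto
    then show ?thesis
      by (simp add: contour_integrable_continuous_linepath has_contour_integral_integral)
  qed
  have "((\<lambda>v. contour_integral (linepath a b) (\<lambda>\<zeta>. f \<zeta> / (\<zeta> - v))) has_field_derivative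
      (of_nat 1 * contour_integral (linepath a b) (\<lambda>\<zeta>. f \<zeta> / (\<zeta> - z) ^ Suc 1))) (at z)"
    using f z by (intro Cauchy_next_derivative(2)[where S = UNIV and B = "norm (b - a)", OF _ _ int]) auto
  then show "isCont (\<lambda>z. contour_integral (linepath a b) (\<lambda>\<zeta>. f \<zeta> / (\<zeta> - z))) z"
    by (rule DERIV_isCont)
qed

lemma continuous_on_boundary_integral:
  assumes f: "continuous_on (frontier (lattice_region w h J)) f"
  shows "continuous_on (polygonal_set w h J)
    (\<lambda>z. boundary_integral w h J (\<lambda>\<zeta>. f \<zeta> / (\<zeta> - z)))"
  unfolding boundary_integral_def
proof (rule continuous_on_sum, clarsimp)
  fix a b assume "(a, b) \<in> boundary_sides w h J"
  then have ab: "closed_segment a b \<subseteq> frontier (lattice_region w h J)"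
    by (auto simp: boundary_sides_def)
  have "polygonal_set w h J \<subseteq> - closed_segment a b"
    using ab by (auto simp: polygonal_set_def frontier_def)
  then show "continuous_on (polygonal_set w h J)
      (\<lambda>z. contour_integral (linepath a b) (\<lambda>\<zeta>. f \<zeta> / (\<zeta> - z)))"
    using continuous_on_cauchy_integral_linepath[OF continuous_on_subset[OF f ab]]
      continuous_on_subset by blast
qed

lemma continuous_on_eq_on_dense_subset:
  fixes f g :: "'a::topological_space \<Rightarrow> 'b::real_normed_vector"
  assumes "continuous_on S f" "continuous_on S g" "D \<subseteq> S" "S \<subseteq> closure D"
    and eq: "\<And>x. x \<in> D \<Longrightarrow> f x = g x" and "x \<in> S"
  shows "f x = g x"
proof -
  have "closedin (top_of_set S) {x \<in> S. f x - g x = 0}"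
    by (intro continuous_closedin_preimage_constant continuous_on_diff assms)
  then obtain T where T: "closed T" "{x \<in> S. f x - g x = 0} = S \<inter> T"
    by (auto simp: closedin_closed)
  then have "D \<subseteq> T" using assms(3) eq by auto
  then have "x \<in> S \<inter> T" using T(1) assms(4,6) closure_minimal by blast
  then show ?thesis using T(2) by auto
qed

lemma boundary_integral_cauchy_formula:
  assumes h: "h > 0" and J: "finite J" and f: "f holomorphic_on lattice_region w h J"
    and z: "z \<in> polygonal_set w h J"
  shows "boundary_integral w h J (\<lambda>\<zeta>. f \<zeta> / (\<zeta> - z)) = 2 * pi * \<i> * f z"
proof (rule continuous_on_eq_on_dense_subset[OF _ _ open_squares_subset_polygonal_set _ _ z])
  have cf: "continuous_on (lattice_region w h J) f"
    using f by (rule holomorphic_on_imp_continuous_on)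
  have "frontier (lattice_region w h J) \<subseteq> lattice_region w h J"
    by (simp add: J compact_imp_closed compact_lattice_region frontier_subset_closed)
  then show "continuous_on (polygonal_set w h J)
      (\<lambda>z. boundary_integral w h J (\<lambda>\<zeta>. f \<zeta> / (\<zeta> - z)))"
    by (intro continuous_on_boundary_integral continuous_on_subset[OF cf])
  have sub: "polygonal_set w h J \<subseteq> lattice_region w h J"
    by (simp add: polygonal_set_def interior_subset)
  then show "continuous_on (polygonal_set w h J) (\<lambda>z. 2 * pi * \<i> * f z)"
    by (intro continuous_intros continuous_on_subset[OF cf])
  show "polygonal_set w h J \<subseteq> closure (\<Union>j\<in>J. open_square w h j)"
    using sub lattice_region_eq_closure[OF h J] by metis
qed (use boundary_integral_cauchy_formula_open_square[OF h J f] in blast)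

section \<open>A region between a compact and an open set\<close>

lemma in_some_lattice_square:
  assumes "h > 0"
  obtains j where "z \<in> lattice_square w h j"
proof -
  define m n where "m = \<lfloor>(Re z - Re w) / h\<rfloor>" and "n = \<lfloor>(Im z - Im w) / h\<rfloor>"
  have "of_int \<lfloor>t / h\<rfloor> * h \<le> t \<and> t \<le> (of_int \<lfloor>t / h\<rfloor> + 1) * h" for t
    using assms floor_correct[of "t / h"]
      mult_right_mono[of "of_int \<lfloor>t / h\<rfloor>" "t / h" h]
      mult_right_mono[of "t / h" "of_int \<lfloor>t / h\<rfloor> + 1" h]
    by simp
  from this[of "Re z - Re w"] this[of "Im z - Im w"]
  have "z \<in> lattice_square w h (m, n)"
    by (simp add: lattice_square_def in_cbox_complex_iff m_def n_def algebra_simps)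
  then show ?thesis using that by blast
qed

lemma dist_lattice_square:
  assumes "x \<in> lattice_square w h j" "y \<in> lattice_square w h j"
  shows "dist x y \<le> 2 * h"
proof -
  have "\<bar>Re (x - y)\<bar> \<le> h" "\<bar>Im (x - y)\<bar> \<le> h"
    using assms by (cases j; auto simp: lattice_square_def in_cbox_complex_iff algebra_simps)+
  then show ?thesis
    using cmod_le[of "x - y"] by (simp add: dist_norm)
qed

lemma finite_squares_meeting_bounded:
  assumes "h > 0" "bounded B"
  shows "finite {j. lattice_square w h j \<inter> B \<noteq> {}}"
proof -
  obtain R where R: "\<And>z. z \<in> B \<Longrightarrow> dist w z \<le> R"
    using assms(2) bounded_any_center[of B w] by auto
  define N where "N = \<lceil>R / h\<rceil> + 1"
  have bound: "p \<in> {-N..N}" if "of_int p * h \<le> t" "t \<le> (of_int p + 1) * h" "\<bar>t\<bar> \<le> R" for p t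
  proof -
    have "of_int p \<le> R / h" "- R / h \<le> of_int p + 1"
      using that assms(1) by (auto simp: field_simps)
    then show ?thesis unfolding N_def by (simp, linarith)
  qed
  have "{j. lattice_square w h j \<inter> B \<noteq> {}} \<subseteq> {-N..N} \<times> {-N..N}"
  proof
    fix j assume "j \<in> {j. lattice_square w h j \<inter> B \<noteq> {}}"
    then obtain z where "z \<in> lattice_square w h j" "z \<in> B" by blast
    moreover obtain m n where j: "j = (m, n)" by (cases j)
    ultimately have z: "z \<in> lattice_square w h (m, n)" "z \<in> B" by simp_all
    have "\<bar>Re (w - z)\<bar> \<le> R" "\<bar>Im (w - z)\<bar> \<le> R"
      using R[OF z(2)] abs_Re_le_cmod[of "w - z"] abs_Im_le_cmod[of "w - z"]
      by (simp_all add: dist_norm)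
    then show "j \<in> {-N..N} \<times> {-N..N}"
      unfolding j using z(1) by (intro SigmaI bound[of m "Re z - Re w"] bound[of n "Im z - Im w"])
        (auto simp: lattice_square_def in_cbox_complex_iff algebra_simps)
  qed
  then show ?thesis by (rule finite_subset) simp
qed

lemma lattice_region_between_compact_and_open:
  fixes K U :: "complex set"
  assumes "open U" "compact K" "K \<subseteq> U"
  obtains h :: real and J where "h > 0" "finite J" "K \<subseteq> polygonal_set w h J"
    "lattice_region w h J \<subseteq> U"
proof -
  obtain e where e: "e > 0" "(\<Union>x\<in>K. ball x e) \<subseteq> U"
    using compact_subset_open_imp_ball_epsilon_subset[OF assms(2,1,3)] by blast
  \<comment> \<open>A point of a square that meets the \<open>h\<close>-neighbourhood of \<open>K\<close> has distance
    less than \<open>h + 2 * h < e\<close> from \<open>K\<close>.\<close>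
  define h where "h = e / 4"
  \<comment> \<open>The squares meeting the open set \<open>B\<close> cover it, which puts \<open>B\<close>, and
    therefore \<open>K\<close>, into the interior of their union.\<close>
  define B where "B = (\<Union>x\<in>K. ball x h)"
  define J where "J = {j. lattice_square w h j \<inter> B \<noteq> {}}"
  have h: "h > 0" using e by (simp add: h_def)
  obtain R where R: "\<And>x. x \<in> K \<Longrightarrow> norm x \<le> R"
    using compact_imp_bounded[OF assms(2)] by (auto simp: bounded_iff)
  have "norm y \<le> R + h" if "x \<in> K" "dist x y < h" for x y
    using R[OF that(1)] that(2) norm_triangle_sub[of y x] by (simp add: dist_norm norm_minus_commute)
  then have "bounded B"
    unfolding bounded_iff B_def by (intro exI[of _ "R + h"]) auto
  then have "finite J" unfolding J_def by (rule finite_squares_meeting_bounded[OF h])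
  moreover have "B \<subseteq> lattice_region w h J"
  proof
    fix z assume "z \<in> B"
    moreover obtain j where "z \<in> lattice_square w h j" using in_some_lattice_square[OF h] .
    ultimately show "z \<in> lattice_region w h J" unfolding lattice_region_def J_def by blast
  qed
  then have "B \<subseteq> polygonal_set w h J"
    unfolding polygonal_set_def B_def by (intro interior_maximal) auto
  then have "K \<subseteq> polygonal_set w h J"
    using h by (force simp: B_def)
  moreover have "lattice_region w h J \<subseteq> U"
  proof
    fix z assume "z \<in> lattice_region w h J"
    then obtain j y x where "z \<in> lattice_square w h j" "y \<in> lattice_square w h j"
        "x \<in> K" "dist x y < h"
      by (auto simp: lattice_region_def J_def B_def)
    then have "dist x z < e"
      using dist_lattice_square[of y w h j z] dist_triangle[of x z y] h by (simp add: h_def)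
    then have "z \<in> (\<Union>x\<in>K. ball x e)" using \<open>x \<in> K\<close> by auto
    then show "z \<in> U" using e(2) by blast
  qed
  ultimately show ?thesis using that h by blast
qed

section \<open>Cauchy's formula for a polygonal neighbourhood of a compact set\<close>

theorem theorem6:
  fixes U K :: "complex set"
  assumes "open U" and "compact K" and "K \<subseteq> U"
  shows "\<exists>(w :: complex) (h :: real) (J :: (int \<times> int) set) (P :: complex set).
           h > 0 \<and> finite J \<and> P = polygonal_set w h J \<and> open P \<and>
           K \<subseteq> P \<and> P \<subseteq> closure P \<and> closure P \<subseteq> U \<and>
           (\<forall>f :: complex \<Rightarrow> complex. f holomorphic_on U \<longrightarrow>
              (\<forall>z\<in>P. 1 / (2 * of_real pi * \<i>) *
                 boundary_integral w h J (\<lambda>\<zeta>. f \<zeta> / (\<zeta> - z)) = f z) \<and>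
              (\<forall>z\<in>U - closure P. 1 / (2 * of_real pi * \<i>) *
                 boundary_integral w h J (\<lambda>\<zeta>. f \<zeta> / (\<zeta> - z)) = 0))"
proof -
  obtain h :: real and J where hJ: "h > 0" "finite J" and K: "K \<subseteq> polygonal_set 0 h J"
    and U: "lattice_region 0 h J \<subseteq> U"
    using lattice_region_between_compact_and_open[OF assms] .
  note closure = closure_polygonal_set[OF hJ, of 0]
  have "1 / (2 * of_real pi * \<i>) * boundary_integral 0 h J (\<lambda>\<zeta>. f \<zeta> / (\<zeta> - z)) = f z"
    if "f holomorphic_on U" "z \<in> polygonal_set 0 h J" for f z
    using boundary_integral_cauchy_formula[OF hJ holomorphic_on_subset[OF that(1) U] that(2)]
    by simp
  moreover have "1 / (2 * of_real pi * \<i>) * boundary_integral 0 h J (\<lambda>\<zeta>. f \<zeta> / (\<zeta> - z)) = 0"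
    if "f holomorphic_on U" "z \<in> U - closure (polygonal_set 0 h J)" for f z
    using boundary_integral_cauchy_theorem[OF hJ holomorphic_on_subset[OF that(1) U]] that(2)
    by (simp add: closure)
  moreover have "open (polygonal_set 0 h J)" by (simp add: polygonal_set_def)
  ultimately show ?thesis
    using hJ K U closure closure_subset[of "polygonal_set 0 h J"]
    by (intro exI[of _ 0] exI[of _ h] exI[of _ J] exI[of _ "polygonal_set 0 h J"]) simp
qed

end
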